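(* Let $r\ge 2$, let $\mathbf{a}=(a_1,\dots,a_r)$ be an $r$-tuple of positive integers which are pairwise coprime, and let $\mathbf{b}=(b_1,\dots,b_r)$ be an $r$-tuple of integers with $0\le b_j\le a_j-1$ for each $j=1,\dots,r$. For each integer $n\ge 2$ let $\mathbf{X}^{(n)}=(X^{(n)}_1,\dots,X^{(n)}_r)$, where the $X^{(n)}_j$ are independent random variables uniformly distributed in $\{1,\dots,n\}$. Then: (a) $$\lim_{n\to\infty}\mathbf{P}\big(\mathbf{X}^{(n)}\in\mathcal{PC}^{\mathbf{a},\mathbf{b}}\big)=T_r\,\frac{\Psi_{r-2}(|\mathbf{a}|)}{\Psi_{r-1}(|\mathbf{a}|)}\,\frac{1}{\varphi(|\mathbf{a}|)}\prod_{i=1}^r\frac{\varphi(\gcd(a_i,b_i))}{\Psi_{r-2}(\gcd(a_i,b_i))}.$$ (b) $$\lim_{n\to\infty}\mathbf{P}\big(\mathbf{X}^{(n)}\in\mathcal{C}^{\mathbf{a},\mathbf{b}}\big)=\frac{1}{\zeta(r)}\,\frac{1}{|\mathbf{a}|}\,\frac{|\mathbf{a}|^r}{\varphi_r(|\mathbf{a}|)}\prod_{i=1}^r\frac{\varphi_{r-1}(\gcd(a_i,b_i))}{\gcd(a_i,b_i)^{r-1}}.$$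
   Context: $|\mathbf{a}|=a_1a_2\cdots a_r$, and $\gcd(a,0)=a$. $\mathcal{PC}^{\mathbf{a},\mathbf{b}}$ is the set of $r$-tuples $\mathbf{x}=(x_1,\dots,x_r)$ of positive integers such that $\gcd(x_i,x_j)=1$ for all $i\neq j$ (pairwise coprime) and $a_i\mid x_i-b_i$ for all $i=1,\dots,r$. $\mathcal{C}^{\mathbf{a},\mathbf{b}}$ is the set of $r$-tuples $\mathbf{x}$ of positive integers such that $\gcd(x_1,\dots,x_r)=1$ (mutually coprime) and $a_i\mid x_i-b_i$ for all $i=1,\dots,r$. $T_r=\prod_p\big((1-\frac1p)^r+\frac rp(1-\frac1p)^{r-1}\big)$, the product being over all primes $p$. $\zeta$ is the Riemann zeta function. For each integer $s$, $\Psi_s(1)=1$ and $\Psi_s(a)=a\prod_{p\mid a}(1+\frac sp)$ for integers $a>1$ (product over primes $p$ dividing $a$). For each integer $s\ge1$ the Jordan totient function is $\varphi_s(1)=1$, $\varphi_s(a)=a^s\prod_{p\mid a}(1-\frac1{p^s})$ for $a>1$; $\varphi=\varphi_1$ is Euler's function. *)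

theory Defs
  imports "HOL-Probability.Probability" "HOL-Number_Theory.Number_Theory"
begin

text \<open>An \<open>r\<close>-tuple of natural numbers is a function on the index set \<open>{1..r}\<close>;
  where sets of tuples are formed, it is extensional (\<open>undefined\<close> outside \<open>{1..r}\<close>).\<close>

definition PC_set :: "nat \<Rightarrow> (nat \<Rightarrow> nat) \<Rightarrow> (nat \<Rightarrow> nat) \<Rightarrow> (nat \<Rightarrow> nat) set" where
  "PC_set r a b = {x \<in> {1..r} \<rightarrow>\<^sub>E {0<..}.
     (\<forall>i\<in>{1..r}. \<forall>j\<in>{1..r}. i \<noteq> j \<longrightarrow> gcd (x i) (x j) = 1) \<and>
     (\<forall>i\<in>{1..r}. int (a i) dvd int (x i) - int (b i))}"

definition C_set :: "nat \<Rightarrow> (nat \<Rightarrow> nat) \<Rightarrow> (nat \<Rightarrow> nat) \<Rightarrow> (nat \<Rightarrow> nat) set" where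
  "C_set r a b = {x \<in> {1..r} \<rightarrow>\<^sub>E {0<..}.
     Gcd (x ` {1..r}) = 1 \<and>
     (\<forall>i\<in>{1..r}. int (a i) dvd int (x i) - int (b i))}"

text \<open>The product over all primes is written as a product over all natural numbers
  whose factors at non-primes are \<open>1\<close>.\<close>

definition T_const :: "nat \<Rightarrow> real" where
  "T_const r = (\<Prod>p. if prime p
     then (1 - 1 / real p) ^ r + real r / real p * (1 - 1 / real p) ^ (r - 1) else 1)"

text \<open>The Riemann zeta function on the real half-line \<open>s > 1\<close>, where it is given by its
  Dirichlet series.  The value is not meaningful for \<open>s \<le> 1\<close>.\<close>

definition zeta :: "real \<Rightarrow> real" where
  "zeta s = (\<Sum>n. 1 / real (Suc n) powr s)"

text \<open>Both functions below are meant for \<open>a > 0\<close>.  At \<open>a = 1\<close> the product is empty, so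
  the value is \<open>1\<close>.\<close>

definition Psi :: "int \<Rightarrow> nat \<Rightarrow> real" where
  "Psi s a = real a * (\<Prod>p\<in>prime_factors a. 1 + real_of_int s / real p)"

definition jordan_totient :: "nat \<Rightarrow> nat \<Rightarrow> real" where
  "jordan_totient s a = real a ^ s * (\<Prod>p\<in>prime_factors a. 1 - 1 / real p ^ s)"

lemma jordan_totient_1: "jordan_totient 1 a = real (totient a)"
  by (simp add: jordan_totient_def totient_formula2)

end

theory Submission
  imports Defs
begin

text \<open>Both coprimality conditions say that, for every prime \<open>p\<close>, the set of coordinates divisible
  by \<open>p\<close> lies in a family \<open>F\<close> of index sets containing the empty set and the singletons: these
  alone for pairwise coprimality, and all proper subsets for mutual coprimality. If only finitely
  many primes are considered, prescribing for each of them which coordinates it divides makes the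
  count a product of one-dimensional counts in residue classes, so the density is a product of
  local factors. A prime \<open>p > y\<close> can violate the condition only if it divides two coordinates, so
  the primes above \<open>y\<close> contribute an error at most \<open>r\<^sup>2 / y\<close>, uniformly in \<open>n\<close>.\<close>

subsection \<open>Finitely many primes\<close>

text \<open>Natural density is not countably additive, so the finite count does not simply carry
  over to all primes; a bound on the discarded primes valid for every n > 0 is what lets y grow
  after n. The closed forms come from comparing each local factor with its value when p does not
  divide |a|, which is the factor of T_r in (a) and 1 - 1/p^r in (b). If p divides |a|, it divides
  exactly one a_k, since the a_i are pairwise coprime. The congruence then decides whether p divides
  x_k, according to whether p divides b_k, while the other r - 1 coordinates are divisible with
  density 1/p. The quotient by the generic factor splits into one part for every p dividing |a| and
  a further part for p dividing gcd(a_k, b_k). The first parts give the terms in |a|, the second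
  parts the product over i. The density 1/|a| of the residue classes remains visible in (b); in (a)
  it is absorbed into 1/phi(|a|).\<close>

text \<open>For a prime \<open>p\<close>, this is the density of the multiples of \<open>p\<close> within the residue class of \<open>b\<close>
  modulo \<open>m\<close>.\<close>

definition dvd_prob :: "nat \<Rightarrow> nat \<Rightarrow> nat \<Rightarrow> real" where
  "dvd_prob m b p = (if p dvd m then of_bool (p dvd b) else 1 / real p)"

text \<open>The members of the class are Suc c, Suc c + m, and so on. Representing it by an element
  of {1..m} fits the range {1..n}, and adding m before subtracting avoids truncation, as c < m. From
  n to n + 1 the quotient grows exactly when m divides the new numerator.\<close>

lemma card_cong_Suc:
  assumes "m > 0" "c < m"
  shows "card {x\<in>{1..n}. x mod m = Suc c mod m} = (n + m - Suc c) div m"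
proof (induction n)
  case 0
  show ?case using assms by simp
next
  case (Suc n)
  define k where "k = n + m - Suc c"
  have k: "Suc n + m - Suc c = Suc k" "n + m = k + Suc c" using assms by (auto simp: k_def)
  have "(Suc n mod m = Suc c mod m) = ((Suc n + m) mod m = Suc c mod m)"
    by (metis mod_add_self2)
  also have "Suc n + m = Suc k + Suc c" using k by simp
  also have "(Suc k + Suc c) mod m = Suc c mod m \<longleftrightarrow> Suc k mod m = 0"
    by (metis cong_def cong_add_rcancel_0_nat mod_0)
  finally have eq: "(Suc n mod m = Suc c mod m) = (Suc k mod m = 0)" .
  have "{x\<in>{1..Suc n}. x mod m = Suc c mod m} =
     (if Suc n mod m = Suc c mod m then insert (Suc n) {x\<in>{1..n}. x mod m = Suc c mod m}
      else {x\<in>{1..n}. x mod m = Suc c mod m})"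
    by (auto simp: le_Suc_eq)
  hence "card {x\<in>{1..Suc n}. x mod m = Suc c mod m} = 
     k div m + (if Suc k mod m = 0 then 1 else 0)"
    using Suc eq by (simp add: k_def)
  also have "\<dots> = Suc k div m"
    by (simp add: div_Suc)
  finally show ?case using k by simp
qed

lemma density_cong:
  assumes "m > 0"
  shows "(\<lambda>n. real (card {x\<in>{1..n}. [x = b] (mod m)}) / real n) \<longlonglongrightarrow> 1 / real m"
proof -
  \<comment> \<open>This is b - 1 modulo m; the summand m keeps the subtraction exact when b =
    0.\<close>
  define c where "c = (b + m - 1) mod m"
  have c: "c < m" using assms by (simp add: c_def)
  have "Suc c mod m = Suc (b + m - 1) mod m"
    unfolding c_def by (rule mod_Suc_eq)
  also have "\<dots> = b mod m" using assms by simp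
  finally have "Suc c mod m = b mod m" .
  hence eq: "card {x\<in>{1..n}. [x = b] (mod m)} = (n + m - Suc c) div m" for n
    using card_cong_Suc[OF assms c, of n] by (simp add: cong_def)
  have "(\<lambda>n. real (card {x\<in>{1..n}. [x = b] (mod m)}) / real n - 1 / real m) \<longlonglongrightarrow> 0"
  proof (rule tendsto_0_le[where K = 1])
    show "(\<lambda>n. 1 / real n) \<longlonglongrightarrow> 0" by (rule lim_1_over_n)
    show "\<forall>\<^sub>F n in sequentially. norm (real (card {x\<in>{1..n}. [x = b] (mod m)}) / real n - 1 / real m)
            \<le> norm (1 / real n) * 1"
      using eventually_gt_at_top[of 0]
    proof eventually_elim
      case (elim n)
      define q where "q = (n + m - Suc c) div m"
      have "q * m \<le> n + m - Suc c" "n + m - Suc c < q * m + m" 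
        using assms dividend_less_div_times[of m "n + m - Suc c"] unfolding q_def
        by (auto simp: add.commute)
      hence "q * m \<le> n + m" "n \<le> q * m + m" using c by linarith+
      hence "real q * m \<le> n + m" "n \<le> real q * m + m" by (simp_all flip: of_nat_mult of_nat_add)
      \<comment> \<open>The count q differs from n / m by at most 1, so the densities differ by at
        most 1 / n.\<close>
      hence "\<bar>real q * m - n\<bar> \<le> m" by linarith
      hence "\<bar>real q * m - n\<bar> / (n * m) \<le> m / (n * m)" by (intro divide_right_mono) auto
      moreover have "\<bar>real q / n - 1 / m\<bar> = \<bar>(real q * m - n) / (n * m)\<bar>"
        using elim assms by (simp add: field_simps)
      ultimately show ?case using elim assms unfolding eq q_def[symmetric] by simp
    qed
  qed
  thus ?thesis by (simp add: LIM_zero_iff)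
qed

text \<open>If p divides m, divisibility of x by p is already fixed by b. Otherwise the Chinese
  remainder theorem merges "p divides x" with the congruence into one class modulo
  \<open>m * p\<close>, and the complementary case follows by subtraction. This is why the induction
  generalises m and b.\<close>

lemma density_cong_pattern:
  assumes "finite A" "\<And>p. p \<in> A \<Longrightarrow> prime p" "m > 0"
  shows "(\<lambda>n. real (card {x\<in>{1..n}. [x = b] (mod m) \<and> (\<forall>p\<in>A. p dvd x \<longleftrightarrow> p \<in> E)}) / real n)
    \<longlonglongrightarrow> 1 / real m * (\<Prod>p\<in>A. if p \<in> E then dvd_prob m b p else 1 - dvd_prob m b p)"
  using assms
proof (induction A arbitrary: m b rule: finite_induct)
  case empty
  thus ?case using density_cong[of m b] by simp
next
  case (insert p A)
  define w where "w = (\<lambda>m b q. if q \<in> E then dvd_prob m b q else 1 - dvd_prob m b q)"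
  define S where "S = (\<lambda>m b n. {x\<in>{1..n}. [x = b] (mod m) \<and> (\<forall>p\<in>A. p dvd x \<longleftrightarrow> p \<in> E)})"
  have IH: "(\<lambda>n. real (card (S m b n)) / real n) \<longlonglongrightarrow> 1 / real m * (\<Prod>q\<in>A. w m b q)" if "m > 0" for m b
    unfolding S_def w_def by (rule insert.IH) (use insert.prems that in auto)
  have p: "prime p" using insert.prems by auto
  have split: "{x\<in>{1..n}. [x = b] (mod m) \<and> (\<forall>q\<in>insert p A. q dvd x \<longleftrightarrow> q \<in> E)} =
       {x\<in>S m b n. p dvd x \<longleftrightarrow> p \<in> E}" for n by (auto simp: S_def)
  have fin: "finite (S m b n)" for m b n by (simp add: S_def)
  have "(\<lambda>n. real (card {x\<in>S m b n. p dvd x \<longleftrightarrow> p \<in> E}) / real n) \<longlonglongrightarrow>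
          1 / real m * (w m b p * (\<Prod>q\<in>A. w m b q))"
  proof (cases "p dvd m")
    case True
    have "{x\<in>S m b n. p dvd x \<longleftrightarrow> p \<in> E} = (if p dvd b \<longleftrightarrow> p \<in> E then S m b n else {})" for n
      using True by (auto simp: S_def) (metis cong_dvd_iff cong_dvd_modulus_nat)+
    moreover have "w m b p = (if p dvd b \<longleftrightarrow> p \<in> E then 1 else 0)"
      using True by (auto simp: w_def dvd_prob_def)
    ultimately show ?thesis using IH[OF insert.prems(2), of b] by auto
  next
    case False
    hence "coprime m p" using p by (metis coprime_commute prime_imp_coprime)
    then obtain b' where b': "[b' = b] (mod m)" "[b' = 0] (mod p)"
      using binary_chinese_remainder_nat by blast
    have T: "{x\<in>S m b n. p dvd x} = S (m * p) b' n" for n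
    proof -
      have "[x = b] (mod m) \<and> p dvd x \<longleftrightarrow> [x = b'] (mod (m * p))" for x
      proof -
        have "[x = b'] (mod (m * p)) \<longleftrightarrow> [x = b'] (mod m) \<and> [x = b'] (mod p)"
          using \<open>coprime m p\<close> coprime_cong_mult_nat cong_modulus_mult_nat
          by (metis mult.commute)
        also have "[x = b'] (mod m) \<longleftrightarrow> [x = b] (mod m)"
          using b' cong_trans cong_sym by blast
        also have "[x = b'] (mod p) \<longleftrightarrow> p dvd x"
          using b' by (metis cong_0_iff cong_trans cong_sym)
        finally show ?thesis by blast
      qed
      thus ?thesis unfolding S_def by blast
    qed
    \<comment> \<open>Enlarging the modulus leaves the weights at the other primes unchanged: q
      divides \<open>m * p\<close> only if it divides m, and then b' and b agree modulo q.\<close>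
    have w_eq: "w (m * p) b' q = w m b q" if "q \<in> A" for q
    proof -
      have "prime q" "q \<noteq> p" using that insert by auto
      hence "q dvd m * p \<longleftrightarrow> q dvd m" using p
        by (metis prime_dvd_mult_iff primes_dvd_imp_eq)
      moreover have "q dvd b' \<longleftrightarrow> q dvd b" if "q dvd m"
        using b' that by (metis cong_dvd_iff cong_dvd_modulus_nat)
      ultimately show ?thesis by (simp add: w_def dvd_prob_def)
    qed
    have mp: "m * p > 0" using insert.prems p by (simp add: prime_gt_0_nat)
    have L1: "(\<lambda>n. real (card {x\<in>S m b n. p dvd x}) / real n) \<longlonglongrightarrow>
         1 / real m * (1 / real p * (\<Prod>q\<in>A. w m b q))"
      using IH[OF mp, of b'] by (simp add: T w_eq)
    have "real (card (S m b n)) - real (card {x\<in>S m b n. p dvd x}) =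
        real (card {x\<in>S m b n. \<not> p dvd x})" for n
    proof -
      have "S m b n = {x\<in>S m b n. p dvd x} \<union> {x\<in>S m b n. \<not> p dvd x}" by auto
      hence "card (S m b n) = card {x\<in>S m b n. p dvd x} + card {x\<in>S m b n. \<not> p dvd x}"
        using fin by (subst card_Un_disjoint [symmetric]) auto
      thus ?thesis by simp
    qed
    hence L2: "(\<lambda>n. real (card {x\<in>S m b n. \<not> p dvd x}) / real n) \<longlonglongrightarrow>
         1 / real m * ((1 - 1 / real p) * (\<Prod>q\<in>A. w m b q))"
      using tendsto_diff[OF IH[OF insert.prems(2), of b] L1]
      by (simp add: algebra_simps flip: diff_divide_distrib)
    have "w m b p = (if p \<in> E then 1 / real p else 1 - 1 / real p)"
      using False by (simp add: w_def dvd_prob_def)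
    thus ?thesis using L1 L2 by (cases "p \<in> E") (simp_all add: mult_ac)
  qed
  thus ?case unfolding split using insert.hyps by (simp add: w_def)
qed

text \<open>The factor at \<open>p\<close> when \<open>F\<close> is the family of admissible sets of coordinates divisible by \<open>p\<close>.\<close>

definition local_density :: "'i set \<Rightarrow> 'i set set \<Rightarrow> ('i \<Rightarrow> nat) \<Rightarrow> ('i \<Rightarrow> nat) \<Rightarrow> nat \<Rightarrow> real" where
  "local_density I F a b p =
     (\<Sum>D\<in>F. \<Prod>i\<in>I. if i \<in> D then dvd_prob (a i) (b i) p else 1 - dvd_prob (a i) (b i) p)"

text \<open>Each function \<open>e\<close> from A to F selects the tuples for which
  \<open>e p\<close> is exactly the set of coordinates divisible by p. These tuples form a box, and
  the boxes for different \<open>e\<close> are disjoint. The limiting weight of a box factorises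
  over primes too, so distributivity turns the sum over \<open>e\<close> into a product over p of
  sums over F.\<close>

lemma density_finite_sieve:
  fixes I :: "'i set"
  assumes I: "finite I" and F: "F \<subseteq> Pow I" and A: "finite A" "\<And>p. p \<in> A \<Longrightarrow> prime p"
    and a: "\<And>i. i \<in> I \<Longrightarrow> a i > 0"
  shows "(\<lambda>n. real (card {x \<in> I \<rightarrow>\<^sub>E {1..n}. (\<forall>i\<in>I. [x i = b i] (mod a i)) \<and>
              (\<forall>p\<in>A. {i\<in>I. p dvd x i} \<in> F)}) / real n ^ card I)
     \<longlonglongrightarrow> (\<Prod>p\<in>A. local_density I F a b p) / real (\<Prod>i\<in>I. a i)"
proof -
  define w where "w = (\<lambda>i p B. if B then dvd_prob (a i) (b i) p else 1 - dvd_prob (a i) (b i) p)"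
  define Q where "Q = (\<lambda>n e i. {x\<in>{1..n}. [x = b i] (mod a i) \<and> (\<forall>p\<in>A. p dvd x \<longleftrightarrow> p \<in> {p. i \<in> e p})})"
  define P where "P = PiE A (\<lambda>_. F)"
  have finF: "finite F" using F I finite_subset by blast
  have finP: "finite P" unfolding P_def using A finF by (intro finite_PiE)
  have pattern: "{i\<in>I. p dvd x i} = e p" if "e \<in> P" "x \<in> PiE I (Q n e)" "p \<in> A" for e x n p
  proof -
    have "e p \<subseteq> I" using that F by (auto simp: P_def)
    moreover have "p dvd x i \<longleftrightarrow> i \<in> e p" if "i \<in> I" for i
      using PiE_mem[OF \<open>x \<in> PiE I (Q n e)\<close> that] \<open>p \<in> A\<close> by (simp add: Q_def)
    ultimately show ?thesis by blast
  qed
  have set_eq: "{x \<in> I \<rightarrow>\<^sub>E {1..n}. (\<forall>i\<in>I. [x i = b i] (mod a i)) \<and>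
        (\<forall>p\<in>A. {i\<in>I. p dvd x i} \<in> F)} = (\<Union>e\<in>P. PiE I (Q n e))" for n
  proof (intro equalityI subsetI)
    fix x assume x: "x \<in> {x \<in> I \<rightarrow>\<^sub>E {1..n}. (\<forall>i\<in>I. [x i = b i] (mod a i)) \<and>
        (\<forall>p\<in>A. {i\<in>I. p dvd x i} \<in> F)}"
    show "x \<in> (\<Union>e\<in>P. PiE I (Q n e))"
    proof
      \<comment> \<open>\<open>restrict\<close> makes the pattern extensional, so that it is
        determined by its values on A and lies in \<open>P\<close>.\<close>
      show "restrict (\<lambda>p. {i\<in>I. p dvd x i}) A \<in> P" using x by (auto simp: P_def)
      show "x \<in> PiE I (Q n (restrict (\<lambda>p. {i\<in>I. p dvd x i}) A))"
        using x by (auto simp: Q_def PiE_iff)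
    qed
  next
    fix x assume "x \<in> (\<Union>e\<in>P. PiE I (Q n e))"
    then obtain e where e: "e \<in> P" "x \<in> PiE I (Q n e)" by auto
    have "{i\<in>I. p dvd x i} = e p" if "p \<in> A" for p
      by (rule pattern[OF e that])
    thus "x \<in> {x \<in> I \<rightarrow>\<^sub>E {1..n}. (\<forall>i\<in>I. [x i = b i] (mod a i)) \<and>
        (\<forall>p\<in>A. {i\<in>I. p dvd x i} \<in> F)}"
    proof -
      have "\<forall>p\<in>A. {i\<in>I. p dvd x i} \<in> F"
        using pattern[OF e] e(1) unfolding P_def by (metis PiE_mem)
      moreover have "\<forall>i\<in>I. x i \<in> Q n e i" using e(2) by (meson PiE_mem)
      moreover have "x \<in> extensional I" using e(2) by (simp add: PiE_def)
      ultimately show ?thesis by (simp add: PiE_iff Q_def)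
    qed
  qed
  have disj: "PiE I (Q n e) \<inter> PiE I (Q n e') = {}" if e: "e \<in> P" "e' \<in> P" "e \<noteq> e'" for n e e'
  proof (rule ccontr)
    assume "PiE I (Q n e) \<inter> PiE I (Q n e') \<noteq> {}"
    then obtain x where x: "x \<in> PiE I (Q n e)" "x \<in> PiE I (Q n e')" by blast
    have "e p = e' p" if "p \<in> A" for p
    proof -
      have "e p = {i\<in>I. p dvd x i}" "e' p = {i\<in>I. p dvd x i}"
        using pattern[OF e(1) x(1) that] pattern[OF e(2) x(2) that] by simp_all
      thus ?thesis by simp
    qed
    hence "e = e'" using e(1,2) unfolding P_def by (metis PiE_ext)
    thus False using e by simp
  qed
  have card_eq: "real (card {x \<in> I \<rightarrow>\<^sub>E {1..n}. (\<forall>i\<in>I. [x i = b i] (mod a i)) \<and>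
        (\<forall>p\<in>A. {i\<in>I. p dvd x i} \<in> F)}) / real n ^ card I =
        (\<Sum>e\<in>P. \<Prod>i\<in>I. real (card (Q n e i)) / real n)" for n
  proof -
    have "card (\<Union>e\<in>P. PiE I (Q n e)) = (\<Sum>e\<in>P. card (PiE I (Q n e)))"
      using finP disj I by (intro card_UN_disjoint) (auto intro!: finite_PiE simp: Q_def)
    also have "\<dots> = (\<Sum>e\<in>P. \<Prod>i\<in>I. card (Q n e i))"
      using I by (simp add: card_PiE)
    finally show ?thesis unfolding set_eq
      by (simp add: sum_divide_distrib prod_dividef)
  qed
  have "(\<lambda>n. \<Sum>e\<in>P. \<Prod>i\<in>I. real (card (Q n e i)) / real n) \<longlonglongrightarrow>
        (\<Sum>e\<in>P. \<Prod>i\<in>I. 1 / real (a i) * (\<Prod>p\<in>A. w i p (p \<in> {p. i \<in> e p})))"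
    unfolding Q_def w_def using A a
    by (intro tendsto_sum tendsto_prod density_cong_pattern) auto
  also have "(\<Sum>e\<in>P. \<Prod>i\<in>I. 1 / real (a i) * (\<Prod>p\<in>A. w i p (p \<in> {p. i \<in> e p}))) =
     (\<Sum>e\<in>P. \<Prod>p\<in>A. \<Prod>i\<in>I. w i p (i \<in> e p)) / real (\<Prod>i\<in>I. a i)"
    by (simp add: prod_dividef sum_divide_distrib prod.swap[of _ A I])
  also have "(\<Sum>e\<in>P. \<Prod>p\<in>A. \<Prod>i\<in>I. w i p (i \<in> e p)) = (\<Prod>p\<in>A. \<Sum>D\<in>F. \<Prod>i\<in>I. w i p (i \<in> D))"
    unfolding P_def using A finF by (simp add: prod_sum_PiE)
  finally show ?thesis unfolding card_eq local_density_def w_def .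
qed

subsection \<open>The contribution of large primes\<close>

lemma card_multiples: "m > 0 \<Longrightarrow> card {x\<in>{1..n}. m dvd x} = n div m" for m n :: nat
  using card_cong_Suc[of m "m - 1" n] by (simp add: dvd_eq_mod_eq_0)

text \<open>Each of the two coordinates has \<open>n div m\<close> choices, and rounding down only
  helps an upper bound. Hence there is no error term, and the estimate is uniform in n.\<close>

lemma card_common_divisor_le:
  fixes I :: "'i set" and m n :: nat
  assumes I: "finite I" "i \<in> I" "j \<in> I" "i \<noteq> j" and m: "m > 0"
  shows "real (card {x \<in> I \<rightarrow>\<^sub>E {1..n}. m dvd x i \<and> m dvd x j}) \<le> real n ^ card I / real m ^ 2"
proof -
  define B where "B = (\<lambda>k. if k \<in> {i, j} then {x\<in>{1..n}. m dvd x} else {1..n})"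
  have "{x \<in> I \<rightarrow>\<^sub>E {1..n}. m dvd x i \<and> m dvd x j} = PiE I B"
    using I by (auto simp: B_def PiE_iff extensional_def split: if_splits)
  hence "real (card {x \<in> I \<rightarrow>\<^sub>E {1..n}. m dvd x i \<and> m dvd x j}) = (\<Prod>k\<in>I. real (card (B k)))"
    using I by (simp add: card_PiE)
  also have "\<dots> \<le> (\<Prod>k\<in>I. real n * (if k \<in> {i, j} then 1 / real m else 1))"
  proof (intro prod_mono conjI)
    fix k show "real (card (B k)) \<le> real n * (if k \<in> {i, j} then 1 / real m else 1)"
    proof -
      have "real (card {x\<in>{1..n}. m dvd x}) \<le> real n / real m"
        unfolding card_multiples[OF m] by (rule of_nat_div_le_of_nat)
      thus ?thesis by (simp add: B_def)
    qed
  qed simp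
  also have "\<dots> = real n ^ card I * (\<Prod>k\<in>I. if k \<in> {i, j} then 1 / real m else 1)"
    by (simp add: prod.distrib)
  also have "(\<Prod>k\<in>I. if k \<in> {i, j} then 1 / real m else 1) = (\<Prod>k\<in>{i, j}. 1 / real m)"
    using I by (intro prod.mono_neutral_cong_right) auto
  finally show ?thesis using I by (simp add: power2_eq_square)
qed

lemma sum_inverse_squares_tail_le:
  assumes "y > 0"
  shows "(\<Sum>m\<in>{y<..n}. 1 / real m ^ 2) \<le> 1 / real y"
proof (cases "y \<le> n")
  case True
  \<comment> \<open>The stronger bound with - 1 / n lets the induction telescope through 1 / m^2 <=
    1 / (m - 1) - 1 / m.\<close>
  hence "(\<Sum>m\<in>{y<..n}. 1 / real m ^ 2) \<le> 1 / real y - 1 / real n"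
  proof (induction n rule: dec_induct)
    case (step n)
    have "{y<..Suc n} = insert (Suc n) {y<..n}" using step by auto
    moreover have "1 / real (Suc n) ^ 2 \<le> 1 / real n - 1 / real (Suc n)"
      using step assms by (simp add: divide_simps power2_eq_square) 
    ultimately show ?case using step.IH by simp
  qed simp
  also have "\<dots> \<le> 1 / real y" by simp
  finally show ?thesis .
qed simp

text \<open>This is a union bound over ordered pairs of distinct coordinates, at most
  \<open>card I ^ 2\<close> of them, and over all integers m > y. Dropping primality of m is
  affordable because the sum of 1 / m^2 converges.\<close>

lemma sieve_tail_bound:
  fixes I :: "'i set" and n y :: nat
  assumes I: "finite I" and F: "{} \<in> F" "\<And>i. i \<in> I \<Longrightarrow> {i} \<in> F" and y: "y > 0"
  shows "real (card {x \<in> I \<rightarrow>\<^sub>E {1..n}. \<exists>p>y. prime p \<and> {i\<in>I. p dvd x i} \<notin> F})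
           \<le> real n ^ card I * (real (card I) ^ 2 / real y)"
proof -
  define J where "J = {ij \<in> I \<times> I. fst ij \<noteq> snd ij}"
  define B where "B = (\<lambda>ij m. {x \<in> I \<rightarrow>\<^sub>E {1..n}. m dvd x (fst ij) \<and> m dvd x (snd ij)})"
  have J: "finite J" "card J \<le> card I ^ 2"
    using I card_mono[of "I \<times> I" J] by (auto simp: J_def card_cartesian_product power2_eq_square)
  have finB: "finite (B ij m)" for ij m
    unfolding B_def using I by (intro finite_subset[OF _ finite_PiE[of I "\<lambda>_. {1..n}"]]) auto
  have "{x \<in> I \<rightarrow>\<^sub>E {1..n}. \<exists>p>y. prime p \<and> {i\<in>I. p dvd x i} \<notin> F} \<subseteq> (\<Union>ij\<in>J. \<Union>m\<in>{y<..n}. B ij m)"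
  proof
    fix x assume "x \<in> {x \<in> I \<rightarrow>\<^sub>E {1..n}. \<exists>p>y. prime p \<and> {i\<in>I. p dvd x i} \<notin> F}"
    then obtain p where x: "x \<in> I \<rightarrow>\<^sub>E {1..n}" and p: "p > y" "{i\<in>I. p dvd x i} \<notin> F" by blast
    have "{i\<in>I. p dvd x i} \<noteq> {}" using p F by metis
    then obtain i where i: "i \<in> I" "p dvd x i" by blast
    have "{i\<in>I. p dvd x i} \<noteq> {i}" using p F(2)[OF i(1)] by metis
    then obtain j where j: "j \<in> I" "p dvd x j" "i \<noteq> j" using i by blast
    \<comment> \<open>Coordinates are positive, so p <= x i <= n; this confines the union to the
      finite range {y<..n}.\<close>
    have xi: "x i \<in> {1..n}" using x i by (meson PiE_mem)
    hence "p \<le> x i" using i(2) by (intro dvd_imp_le) auto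
    hence "p \<in> {y<..n}" using p xi by auto
    thus "x \<in> (\<Union>ij\<in>J. \<Union>m\<in>{y<..n}. B ij m)" 
      using i j x by (intro UN_I[of "(i, j)"] UN_I[of p]) (auto simp: J_def B_def)
  qed
  hence "card {x \<in> I \<rightarrow>\<^sub>E {1..n}. \<exists>p>y. prime p \<and> {i\<in>I. p dvd x i} \<notin> F}
           \<le> card (\<Union>ij\<in>J. \<Union>m\<in>{y<..n}. B ij m)"
    using J finB by (intro card_mono) auto
  also have "\<dots> \<le> (\<Sum>ij\<in>J. \<Sum>m\<in>{y<..n}. card (B ij m))"
    using J by (intro order.trans[OF card_UN_le] sum_mono card_UN_le) auto
  finally have "real (card {x \<in> I \<rightarrow>\<^sub>E {1..n}. \<exists>p>y. prime p \<and> {i\<in>I. p dvd x i} \<notin> F})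
      \<le> (\<Sum>ij\<in>J. \<Sum>m\<in>{y<..n}. real (card (B ij m)))"
    by (simp flip: of_nat_sum)
  also have "\<dots> \<le> (\<Sum>ij\<in>J. \<Sum>m\<in>{y<..n}. real n ^ card I * (1 / real m ^ 2))"
    unfolding B_def using I card_common_divisor_le[OF I]
    by (intro sum_mono) (auto simp: J_def)
  also have "\<dots> = real (card J) * (real n ^ card I * (\<Sum>m\<in>{y<..n}. 1 / real m ^ 2))"
    by (simp add: sum_distrib_left)
  also have "\<dots> \<le> real (card I ^ 2) * (real n ^ card I * (1 / real y))"
    using J y sum_inverse_squares_tail_le[OF y, of n]
    by (intro mult_mono mult_left_mono) (auto intro!: sum_nonneg mult_nonneg_nonneg simp del: of_nat_power)
  finally show ?thesis by (simp add: mult_ac)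
qed

text \<open>An epsilon/3 argument exchanges the two limits. The threshold for n may depend on y,
  because a single sufficiently large y is fixed before n grows.\<close>

lemma LIMSEQ_approx:
  fixes f :: "nat \<Rightarrow> real"
  assumes "\<And>y. g y \<longlonglongrightarrow> D y" "D \<longlonglongrightarrow> L" "e \<longlonglongrightarrow> 0"
    and "\<forall>\<^sub>F y in sequentially. \<forall>\<^sub>F n in sequentially. \<bar>f n - g y n\<bar> \<le> e y"
  shows "f \<longlonglongrightarrow> L"
proof (rule LIMSEQ_I)
  fix \<epsilon> :: real assume eps: "\<epsilon> > 0"
  have "\<forall>\<^sub>F y in sequentially. \<bar>D y - L\<bar> < \<epsilon> / 3" "\<forall>\<^sub>F y in sequentially. \<bar>e y\<bar> < \<epsilon> / 3"
    using tendstoD[OF assms(2), of "\<epsilon> / 3"] tendstoD[OF assms(3), of "\<epsilon> / 3"] eps by (simp_all add: dist_real_def)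
  hence "\<forall>\<^sub>F y in sequentially. \<bar>D y - L\<bar> < \<epsilon> / 3 \<and> \<bar>e y\<bar> < \<epsilon> / 3 \<and>
          (\<forall>\<^sub>F n in sequentially. \<bar>f n - g y n\<bar> \<le> e y)"
    using assms(4) by eventually_elim auto
  then obtain y where y: "\<bar>D y - L\<bar> < \<epsilon> / 3" "\<bar>e y\<bar> < \<epsilon> / 3"
          "\<forall>\<^sub>F n in sequentially. \<bar>f n - g y n\<bar> \<le> e y"
    using eventually_happens by force
  have "\<forall>\<^sub>F n in sequentially. \<bar>g y n - D y\<bar> < \<epsilon> / 3"
    using tendstoD[OF assms(1), of "\<epsilon> / 3"] eps by (simp add: dist_real_def)
  with y(3) have "\<forall>\<^sub>F n in sequentially. norm (f n - L) < \<epsilon>"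
    by eventually_elim (use y(1,2) in \<open>unfold real_norm_def, linarith\<close>)
  thus "\<exists>no. \<forall>n\<ge>no. norm (f n - L) < \<epsilon>" by (simp add: eventually_sequentially)
qed

text \<open>Convergence of the partial products is a hypothesis because it needs a different
  argument for each family F: a Bernoulli estimate in one case, the Euler product in the
  other.\<close>

theorem density_sieve:
  fixes I :: "'i set"
  assumes I: "finite I" and F: "F \<subseteq> Pow I" "{} \<in> F" "\<And>i. i \<in> I \<Longrightarrow> {i} \<in> F"
    and a: "\<And>i. i \<in> I \<Longrightarrow> a i > 0"
    and L: "(\<lambda>y. \<Prod>p | prime p \<and> p \<le> y. local_density I F a b p) \<longlonglongrightarrow> L"
  shows "(\<lambda>n. real (card {x \<in> I \<rightarrow>\<^sub>E {1..n}. (\<forall>i\<in>I. [x i = b i] (mod a i)) \<and>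
              (\<forall>p. prime p \<longrightarrow> {i\<in>I. p dvd x i} \<in> F)}) / real n ^ card I)
     \<longlonglongrightarrow> L / real (\<Prod>i\<in>I. a i)"
proof -
  define S where "S = (\<lambda>n. {x \<in> I \<rightarrow>\<^sub>E {1..n}. (\<forall>i\<in>I. [x i = b i] (mod a i)) \<and>
              (\<forall>p. prime p \<longrightarrow> {i\<in>I. p dvd x i} \<in> F)})"
  define R where "R = (\<lambda>y n. {x \<in> I \<rightarrow>\<^sub>E {1..n}. (\<forall>i\<in>I. [x i = b i] (mod a i)) \<and>
              (\<forall>p\<in>{p. prime p \<and> p \<le> y}. {i\<in>I. p dvd x i} \<in> F)})"
  define E where "E = (\<lambda>(y::nat) (n::nat). {x \<in> I \<rightarrow>\<^sub>E {1..n}. \<exists>p>y. prime p \<and> {i\<in>I. p dvd x i} \<notin> F})"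
  have "(\<lambda>n. real (card (S n)) / real n ^ card I) \<longlonglongrightarrow> L / real (\<Prod>i\<in>I. a i)"
  proof (rule LIMSEQ_approx)
    show "(\<lambda>n. real (card (R y n)) / real n ^ card I) \<longlonglongrightarrow>
             (\<Prod>p | prime p \<and> p \<le> y. local_density I F a b p) / real (\<Prod>i\<in>I. a i)" for y
      unfolding R_def using I F a by (intro density_finite_sieve) auto
    show "(\<lambda>y. (\<Prod>p | prime p \<and> p \<le> y. local_density I F a b p) / real (\<Prod>i\<in>I. a i))
            \<longlonglongrightarrow> L / real (\<Prod>i\<in>I. a i)"
      using I a by (intro tendsto_divide L tendsto_const) auto
    show "(\<lambda>y. real (card I) ^ 2 / real y) \<longlonglongrightarrow> 0" by (rule lim_const_over_n)
    have "\<bar>real (card (S n)) / real n ^ card I - real (card (R y n)) / real n ^ card I\<bar>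
            \<le> real (card I) ^ 2 / real y" if "y > 0" "n > 0" for y n
    proof -
      have fin: "finite (S n)" "finite (R y n)" "finite (E y n)"
        unfolding S_def R_def E_def
        using I by (auto intro!: finite_subset[OF _ finite_PiE[of I "\<lambda>_. {1..n}"]])
      \<comment> \<open>The two counts are compared through the inclusions S <= R <= S union E,
        where E collects the tuples spoilt by a prime above y.\<close>
      have "card (S n) \<le> card (R y n)"
        using fin by (intro card_mono) (auto simp: S_def R_def)
      moreover have "card (R y n) \<le> card (S n \<union> E y n)"
        using fin by (intro card_mono) (auto simp: S_def R_def E_def, metis not_le)
      hence "card (R y n) \<le> card (S n) + card (E y n)"
        using card_Un_le order.trans by blast
      ultimately have "\<bar>real (card (S n)) - real (card (R y n))\<bar> \<le> real (card (E y n))"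
        by linarith
      also have "\<dots> \<le> real n ^ card I * (real (card I) ^ 2 / real y)"
        unfolding E_def using I F that by (intro sieve_tail_bound) auto
      finally have "\<bar>real (card (S n)) - real (card (R y n))\<bar> / real n ^ card I \<le> real (card I) ^ 2 / real y"
        using that by (simp add: divide_simps mult_ac)
      thus ?thesis by (simp flip: diff_divide_distrib)
    qed
    thus "\<forall>\<^sub>F y in sequentially. \<forall>\<^sub>F n in sequentially. \<bar>real (card (S n)) / real n ^ card I - real (card (R y n)) / real n ^ card I\<bar>
            \<le> real (card I) ^ 2 / real y"
      by (intro eventually_mono[OF eventually_gt_at_top[of 0]]) simp
  qed
  thus ?thesis unfolding S_def .
qed

subsection \<open>The local factors\<close>

lemma local_density_altdef:
  assumes "finite I" "F \<subseteq> Pow I"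
  shows "local_density I F a b p =
    (\<Sum>D\<in>F. (\<Prod>i\<in>D. dvd_prob (a i) (b i) p) * (\<Prod>i\<in>I - D. 1 - dvd_prob (a i) (b i) p))"
  unfolding local_density_def
proof (rule sum.cong)
  fix D assume "D \<in> F"
  hence "I \<inter> {i. i \<in> D} = D" "I \<inter> - {i. i \<in> D} = I - D" using assms by auto
  thus "(\<Prod>i\<in>I. if i \<in> D then dvd_prob (a i) (b i) p else 1 - dvd_prob (a i) (b i) p) =
      (\<Prod>i\<in>D. dvd_prob (a i) (b i) p) * (\<Prod>i\<in>I - D. 1 - dvd_prob (a i) (b i) p)"
    using assms(1) by (simp add: prod.If_cases)
qed simp

text \<open>Over all subsets of I the weights sum to the product of u + (1 - u), which is 1;
  removing D = I deletes the term in which p divides every coordinate.\<close>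

lemma local_density_not_all:
  assumes "finite I"
  shows "local_density I (Pow I - {I}) a b p = 1 - (\<Prod>i\<in>I. dvd_prob (a i) (b i) p)"
proof -
  define f where "f = (\<lambda>D. (\<Prod>i\<in>D. dvd_prob (a i) (b i) p) * (\<Prod>i\<in>I - D. 1 - dvd_prob (a i) (b i) p))"
  have "sum f (Pow I) = (\<Prod>i\<in>I. dvd_prob (a i) (b i) p + (1 - dvd_prob (a i) (b i) p))"
    unfolding f_def using assms by (subst prod_add) auto
  hence "sum f (Pow I - {I}) = 1 - f I"
    using assms by (subst sum_diff1) auto
  thus ?thesis using assms by (simp add: local_density_altdef f_def)
qed

lemma local_density_at_most_one:
  assumes "finite I"
  shows "local_density I (insert {} ((\<lambda>i. {i}) ` I)) a b p =
     (\<Prod>i\<in>I. 1 - dvd_prob (a i) (b i) p) +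
     (\<Sum>k\<in>I. dvd_prob (a k) (b k) p * (\<Prod>i\<in>I - {k}. 1 - dvd_prob (a i) (b i) p))"
proof -
  have "inj_on (\<lambda>i. {i}) I" "{} \<notin> (\<lambda>i. {i}) ` I" by auto
  thus ?thesis using assms
    by (subst local_density_altdef) (auto simp: sum.reindex)
qed

lemma prime_dvd_prod_pairwise_coprime:
  fixes a :: "'i \<Rightarrow> nat"
  assumes "finite I" "\<And>i j. i \<in> I \<Longrightarrow> j \<in> I \<Longrightarrow> i \<noteq> j \<Longrightarrow> coprime (a i) (a j)"
    and "prime p" "p dvd prod a I"
  obtains k where "k \<in> I" "p dvd a k" "\<And>i. i \<in> I - {k} \<Longrightarrow> \<not> p dvd a i"
proof -
  obtain k where k: "k \<in> I" "p dvd a k"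
    using assms by (auto simp: prime_dvd_prod_iff)
  moreover have "\<not> p dvd a i" if "i \<in> I - {k}" for i
    using assms(2)[of i k] that k assms(3) by (metis DiffE coprime_common_divisor insertI1 not_prime_unit)
  ultimately show ?thesis using that by blast
qed

text \<open>When p divides a_k and no other a_i, this says that p divides b_k, so that p divides
  every x_k in the prescribed class. Stating it without k allows one product over the primes of
  |a|.\<close>

definition dvd_some_gcd :: "'i set \<Rightarrow> ('i \<Rightarrow> nat) \<Rightarrow> ('i \<Rightarrow> nat) \<Rightarrow> nat \<Rightarrow> bool" where
  "dvd_some_gcd I a b p \<longleftrightarrow> (\<exists>i\<in>I. p dvd gcd (a i) (b i))"

text \<open>If p divides a_k, the chance that p divides all coordinates is 1 / p^(r-1) or 0,
  according to b_k. The result is written as generic factor times correction, so that the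
  corrections form a finite product; the two parts of the correction lead to phi_r(|a|) and to
  phi_(r-1) of the gcds.\<close>

lemma local_density_not_all_factor:
  fixes a :: "'i \<Rightarrow> nat"
  assumes I: "finite I" "card I = r" "r \<ge> 2" and p: "prime p"
    and a: "\<And>i j. i \<in> I \<Longrightarrow> j \<in> I \<Longrightarrow> i \<noteq> j \<Longrightarrow> coprime (a i) (a j)"
  shows "local_density I (Pow I - {I}) a b p = (1 - 1 / real p ^ r) *
     (if p dvd prod a I then 1 / (1 - 1 / real p ^ r) *
        (if dvd_some_gcd I a b p then 1 - 1 / real p ^ (r - 1) else 1) else 1)"
proof (cases "p dvd prod a I")
  case False
  hence "\<not> p dvd a i" if "i \<in> I" for i
    using that I p by (auto simp: prime_dvd_prod_iff)
  thus ?thesis using False I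
    by (simp add: local_density_not_all dvd_prob_def power_one_over)
next
  case True
  obtain k where k: "k \<in> I" "p dvd a k" "\<And>i. i \<in> I - {k} \<Longrightarrow> \<not> p dvd a i"
    using prime_dvd_prod_pairwise_coprime[OF I(1) a p True] by blast
  have gd: "dvd_some_gcd I a b p \<longleftrightarrow> p dvd b k"
    using k by (auto simp: dvd_some_gcd_def)
  have "real p ^ r > 1" using I prime_gt_1_nat[OF p] by (intro one_less_power) auto
  hence "1 - 1 / real p ^ r \<noteq> 0" by (simp add: divide_simps)
  moreover have "(\<Prod>i\<in>I. dvd_prob (a i) (b i) p) = of_bool (p dvd b k) * (1 / real p) ^ (r - 1)"
    using I k by (subst prod.remove[of _ k]) (auto simp: dvd_prob_def)
  ultimately show ?thesis using True I gd
    by (simp add: local_density_not_all power_one_over)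
qed

definition T_factor :: "nat \<Rightarrow> nat \<Rightarrow> real" where
  "T_factor r p = (1 - 1 / real p) ^ r + real r / real p * (1 - 1 / real p) ^ (r - 1)"

text \<open>This form isolates 1 + (r-1)/p, the Euler factor of \<open>Psi\<close> with parameter r
  - 1.\<close>

lemma T_factor_altdef:
  assumes "r > 0"
  shows "T_factor r p = (1 - 1 / real p) ^ (r - 1) * (1 + (real r - 1) / real p)"
proof -
  obtain s where "r = Suc s" using assms by (cases r) auto
  thus ?thesis by (simp add: T_factor_def algebra_simps add_divide_distrib diff_divide_distrib)
qed

text \<open>Let p divide a_k and x = 1/p. If p divides b_k, no other coordinate may be divisible,
  giving (1-x)^(r-1). Otherwise at most one of the other r - 1 may be, giving (1-x)^(r-2) (1 + (r-2)
  x). Dividing by \<open>T_factor\<close> yields the stated corrections.\<close>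

lemma local_density_at_most_one_factor:
  fixes a :: "'i \<Rightarrow> nat"
  assumes I: "finite I" "card I = r" "r \<ge> 2" and p: "prime p"
    and a: "\<And>i j. i \<in> I \<Longrightarrow> j \<in> I \<Longrightarrow> i \<noteq> j \<Longrightarrow> coprime (a i) (a j)"
  shows "local_density I (insert {} ((\<lambda>i. {i}) ` I)) a b p = T_factor r p *
     (if p dvd prod a I then
        (1 + (real r - 2) / real p) / (1 + (real r - 1) / real p) / (1 - 1 / real p) *
        (if dvd_some_gcd I a b p then (1 - 1 / real p) / (1 + (real r - 2) / real p) else 1) else 1)"
proof (cases "p dvd prod a I")
  case False
  hence "\<not> p dvd a i" if "i \<in> I" for i
    using that I p by (auto simp: prime_dvd_prod_iff)
  thus ?thesis using False I
    by (simp add: local_density_at_most_one dvd_prob_def T_factor_def)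
next
  case True
  obtain k where k: "k \<in> I" "p dvd a k" "\<And>i. i \<in> I - {k} \<Longrightarrow> \<not> p dvd a i"
    using prime_dvd_prod_pairwise_coprime[OF I(1) a p True] by blast
  have gd: "dvd_some_gcd I a b p \<longleftrightarrow> p dvd b k"
    using k by (auto simp: dvd_some_gcd_def)
  obtain s where s: "r = Suc (Suc s)" using I(3) by (metis add_2_eq_Suc le_Suc_ex)
  define u where "u = (\<lambda>i. dvd_prob (a i) (b i) p)"
  define x where "x = 1 / real p"
  define z :: real where "z = of_bool (p dvd b k)"
  have uk: "u k = z" using k by (simp add: u_def dvd_prob_def z_def)
  have u: "u i = x" if "i \<in> I - {k}" for i using k(3)[OF that] by (simp add: u_def dvd_prob_def x_def)
  have x: "x > 0" "x < 1" using prime_gt_1_nat[OF p] by (auto simp: x_def)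
  have c1: "card (I - {k}) = Suc s" using I k s by simp
  have P1: "(\<Prod>i\<in>I - {k}. 1 - u i) = (1 - x) ^ Suc s"
    using u c1 by simp
  have P0: "(\<Prod>i\<in>I. 1 - u i) = (1 - z) * (1 - x) ^ Suc s"
    using I k P1 uk by (subst prod.remove[of _ k]) auto
  have P2: "(\<Prod>i\<in>I - {j}. 1 - u i) = (1 - z) * (1 - x) ^ s" if j: "j \<in> I - {k}" for j
  proof -
    have "card (I - {j}) = Suc s" using I s j by simp
    moreover have "k \<in> I - {j}" using k j by auto
    ultimately have "card (I - {j} - {k}) = s" by simp
    moreover have "(\<Prod>i\<in>I - {j}. 1 - u i) = (1 - u k) * (\<Prod>i\<in>I - {j} - {k}. 1 - u i)"
      using I k j by (intro prod.remove) auto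
    ultimately show ?thesis using u uk by simp
  qed
  have "local_density I (insert {} ((\<lambda>i. {i}) ` I)) a b p =
      (\<Prod>i\<in>I. 1 - u i) + (\<Sum>j\<in>I. u j * (\<Prod>i\<in>I - {j}. 1 - u i))"
    unfolding u_def using I by (intro local_density_at_most_one)
  also have "(\<Sum>j\<in>I. u j * (\<Prod>i\<in>I - {j}. 1 - u i)) =
      z * (1 - x) ^ Suc s + (\<Sum>j\<in>I - {k}. x * ((1 - z) * (1 - x) ^ s))"
    using I k by (subst sum.remove[of _ k]) (simp_all add: P1 P2 uk u s)
  also have "(\<Sum>j\<in>I - {k}. x * ((1 - z) * (1 - x) ^ s)) = real (Suc s) * (x * ((1 - z) * (1 - x) ^ s))"
    by (simp add: c1)
  \<comment> \<open>The three summands are: no coordinate divisible, only coordinate k, and only one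
    of the r - 1 others.\<close>
  finally have main: "local_density I (insert {} ((\<lambda>i. {i}) ` I)) a b p =
      (1 - z) * (1 - x) ^ Suc s + (z * (1 - x) ^ Suc s + real (Suc s) * (x * ((1 - z) * (1 - x) ^ s)))"
    unfolding P0 .
  have T: "T_factor r p = (1 - x) ^ Suc s * (1 + real (Suc s) * x)"
    by (simp add: T_factor_altdef s x_def)
  have e: "(real r - 2) / real p = real s * x" "(real r - 1) / real p = real (Suc s) * x"
    by (simp_all add: s x_def)
  have nz: "1 - x \<noteq> 0" "1 + real s * x \<noteq> 0" "1 + real (Suc s) * x \<noteq> 0"
    using x by (auto intro!: add_pos_nonneg order.strict_implies_not_eq[symmetric])
  show ?thesis
  proof (cases "p dvd b k")
    case True
    thus ?thesis using nz \<open>p dvd prod a I\<close> gd unfolding main T e x_def[symmetric]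
      by (simp add: z_def del: of_nat_Suc)
  next
    case False
    have "(1 - x) ^ Suc s + real (Suc s) * (x * (1 - x) ^ s) = (1 - x) ^ s * (1 + real s * x)"
      by (simp add: algebra_simps)
    thus ?thesis using nz False \<open>p dvd prod a I\<close> gd unfolding main T e x_def[symmetric]
      by (simp add: z_def del: of_nat_Suc)
  qed
qed

text \<open>From y = N on, every prime factor of N lies below the cutoff, so the correction is a
  constant factor.\<close>

lemma prod_primes_tendsto_correction:
  fixes f c :: "nat \<Rightarrow> real"
  assumes "(\<lambda>y. \<Prod>p | prime p \<and> p \<le> y. f p) \<longlonglongrightarrow> T" "N > 0"
  shows "(\<lambda>y. \<Prod>p | prime p \<and> p \<le> y. f p * (if p dvd N then c p else 1))
           \<longlonglongrightarrow> T * (\<Prod>p\<in>prime_factors N. c p)"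
proof -
  have "(\<Prod>p | prime p \<and> p \<le> y. f p * (if p dvd N then c p else 1)) =
     (\<Prod>p | prime p \<and> p \<le> y. f p) * (\<Prod>p\<in>prime_factors N. c p)" if "y \<ge> N" for y
  proof -
    have "(\<Prod>p | prime p \<and> p \<le> y. if p dvd N then c p else 1) = (\<Prod>p\<in>prime_factors N. c p)"
      using assms(2) that
      by (intro prod.mono_neutral_cong_right) (auto simp: prime_factors_dvd dest: dvd_imp_le)
    thus ?thesis by (simp add: prod.distrib)
  qed
  hence "\<forall>\<^sub>F y in sequentially. (\<Prod>p | prime p \<and> p \<le> y. f p) * (\<Prod>p\<in>prime_factors N. c p) =
      (\<Prod>p | prime p \<and> p \<le> y. f p * (if p dvd N then c p else 1))"
    by (intro eventually_sequentiallyI[of N]) auto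
  thus ?thesis
    by (rule Lim_transform_eventually[OF tendsto_mult[OF assms(1) tendsto_const]])
qed

text \<open>Pairwise coprimality makes the prime sets of the gcds disjoint, so the double product
  runs over their union.\<close>

lemma prod_prime_factors_gcd:
  fixes a b :: "'i \<Rightarrow> nat" and h :: "nat \<Rightarrow> real"
  assumes I: "finite I" and pos: "\<And>i. i \<in> I \<Longrightarrow> a i > 0"
    and a: "\<And>i j. i \<in> I \<Longrightarrow> j \<in> I \<Longrightarrow> i \<noteq> j \<Longrightarrow> coprime (a i) (a j)"
  shows "(\<Prod>i\<in>I. \<Prod>p\<in>prime_factors (gcd (a i) (b i)). h p) =
         (\<Prod>p\<in>prime_factors (prod a I). if dvd_some_gcd I a b p then h p else 1)"
proof -
  have disj: "prime_factors (gcd (a i) (b i)) \<inter> prime_factors (gcd (a j) (b j)) = {}"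
    if "i \<in> I" "j \<in> I" "i \<noteq> j" for i j
  proof (rule equals0I)
    fix p assume "p \<in> prime_factors (gcd (a i) (b i)) \<inter> prime_factors (gcd (a j) (b j))"
    hence "prime p" "p dvd a i" "p dvd a j" by (auto simp: in_prime_factors_iff)
    thus False using a[OF that] coprime_common_divisor not_prime_unit by blast
  qed
  have "(\<Prod>p\<in>prime_factors (prod a I). if dvd_some_gcd I a b p then h p else 1) =
        (\<Prod>p\<in>(\<Union>i\<in>I. prime_factors (gcd (a i) (b i))). h p)"
  proof (rule prod.mono_neutral_cong_right)
    show "(\<Union>i\<in>I. prime_factors (gcd (a i) (b i))) \<subseteq> prime_factors (prod a I)"
      using I pos by (auto simp: prime_factors_dvd prime_dvd_prod_iff) 
    show "\<forall>p\<in>prime_factors (prod a I) - (\<Union>i\<in>I. prime_factors (gcd (a i) (b i))).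
        (if dvd_some_gcd I a b p then h p else 1) = 1"
      using pos by (fastforce simp: dvd_some_gcd_def prime_factors_dvd)
    show "(if dvd_some_gcd I a b p then h p else 1) = h p" if "p \<in> (\<Union>i\<in>I. prime_factors (gcd (a i) (b i)))" for p
      using that by (auto simp: dvd_some_gcd_def in_prime_factors_iff)
  qed simp
  also have "\<dots> = (\<Prod>i\<in>I. \<Prod>p\<in>prime_factors (gcd (a i) (b i)). h p)"
    using I disj by (intro prod.UNION_disjoint) auto
  finally show ?thesis by simp
qed

text \<open>With x = 1/p and k = r - 1 the factor is (1-x)^k (1+kx). Bernoulli's inequality bounds
  it above by (1-x^2)^k <= 1 and below by (1-kx)(1+kx) = 1 - k^2 x^2. So it differs from 1 by
  O(1/p^2), and the product converges absolutely.\<close>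

lemma T_const_limit:
  assumes "r \<ge> 2"
  shows "(\<lambda>y. \<Prod>p | prime p \<and> p \<le> y. T_factor r p) \<longlonglongrightarrow> T_const r"
proof -
  define f where "f = (\<lambda>p. if prime p then T_factor r p else 1)"
  define k where "k = r - 1"
  have T: "T_factor r p = (1 - 1 / real p) ^ k * (1 + real k * (1 / real p))" for p
    using assms by (simp add: T_factor_altdef k_def of_nat_diff)
  have pos: "f p > 0" for p
    using prime_gt_1_nat[of p] unfolding f_def T
    by (auto intro!: mult_pos_pos zero_less_power add_pos_nonneg)
  have bound: "norm (f p - 1) \<le> real k ^ 2 * (1 / real p ^ 2)" for p
  proof (cases "prime p")
    case True
    define x where "x = 1 / real p"
    have x: "x > 0" "x < 1" using prime_gt_1_nat[OF True] by (auto simp: x_def)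
    have bern: "1 + real k * y \<le> (1 + y) ^ k" if "y \<ge> -1" for y :: real
      using Bernoulli_inequality[OF that, of k] .
    have "f p = (1 - x) ^ k * (1 + real k * x)" using True by (simp add: f_def T x_def)
    moreover have "(1 - x) ^ k * (1 + real k * x) \<le> (1 - x) ^ k * (1 + x) ^ k"
      using bern[of x] x by (intro mult_left_mono) auto
    moreover have "(1 - x) ^ k * (1 + x) ^ k \<le> 1"
      using x by (subst power_mult_distrib[symmetric], intro power_le_one) (auto simp: algebra_simps mult_le_one)
    moreover have "(1 - real k * x) * (1 + real k * x) \<le> (1 - x) ^ k * (1 + real k * x)"
      using bern[of "-x"] x by (intro mult_right_mono) auto
    ultimately have "1 - f p \<ge> 0" "1 - f p \<le> real k ^ 2 * x ^ 2"
      by (auto simp: algebra_simps power2_eq_square)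
    thus ?thesis by (simp add: x_def power_one_over)
  qed (simp add: f_def)
  have "summable (\<lambda>p. norm (f p - 1))"
  proof (rule summable_comparison_test')
    show "summable (\<lambda>p. real k ^ 2 * (1 / real p ^ 2))"
      using inverse_power_summable[of 2, where ?'a = real] by (intro summable_mult) (simp add: field_simps)
  qed (use bound in simp)
  hence "abs_convergent_prod f" by (simp add: abs_convergent_prod_conv_summable)
  hence "convergent_prod f" by (rule abs_convergent_prod_imp_convergent_prod)
  hence "(\<lambda>n. \<Prod>i\<le>n. f i) \<longlonglongrightarrow> prodinf f" by (rule convergent_prod_LIMSEQ)
  moreover have "(\<Prod>i\<le>n. f i) = (\<Prod>p | prime p \<and> p \<le> n. T_factor r p)" for n
    by (rule prod.mono_neutral_cong_right) (auto simp: f_def)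
  moreover have "prodinf f = T_const r"
    unfolding f_def T_const_def T_factor_def by simp
  ultimately show ?thesis by simp
qed

subsection \<open>The Euler product of the zeta function\<close>

text \<open>Sieving out one more prime \<open>p\<close> subtracts the sum over multiples of \<open>p\<close>, which is the
  current sum divided by \<open>p ^ r\<close>.\<close>

lemma zeta_sieve:
  fixes r :: nat
  assumes "r \<ge> 2" "finite A" "\<And>p. p \<in> A \<Longrightarrow> prime p"
  shows "(\<lambda>n. if \<forall>p\<in>A. \<not> p dvd Suc n then 1 / real (Suc n) ^ r else 0) sums
           (zeta r * (\<Prod>p\<in>A. 1 - 1 / real p ^ r))"
  using assms(2,3)
proof (induction A rule: finite_induct)
  case empty
  have "summable (\<lambda>n. 1 / real (Suc n) ^ r)"
    using inverse_power_summable[OF assms(1), where ?'a = real]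
    by (subst summable_Suc_iff) (simp add: field_simps)
  thus ?case by (simp add: zeta_def powr_realpow summable_sums flip: of_nat_Suc)
next
  case (insert p A)
  \<comment> \<open>Indexing by n itself rather than Suc n turns the multiples of p into the plain
    reindexing n to \<open>p * n\<close>; the extra term at 0 vanishes, since division by zero
    yields 0.\<close>
  define f where "f = (\<lambda>n. if \<forall>q\<in>A. \<not> q dvd n then 1 / real n ^ r else 0)"
  define S where "S = zeta r * (\<Prod>p\<in>A. 1 - 1 / real p ^ r)"
  have IH: "(\<lambda>n. f (Suc n)) sums S" unfolding f_def S_def using insert by simp
  have p: "prime p" using insert by simp
  have f0: "f 0 = 0" using assms(1) by (simp add: f_def)
  hence f: "f sums S" using IH by (simp add: sums_Suc_iff)
  have fp: "f (p * n) = f n / real p ^ r" for n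
  proof -
    have "q dvd p * n \<longleftrightarrow> q dvd n" if "q \<in> A" for q
      using that insert p by (metis insertCI prime_dvd_mult_iff primes_dvd_imp_eq)
    thus ?thesis by (simp add: f_def power_mult_distrib)
  qed
  have "(\<lambda>n. f (p * n)) sums (S / real p ^ r)"
    unfolding fp by (rule sums_divide[OF f])
  moreover have mono: "strict_mono (\<lambda>n. p * n)" using prime_gt_0_nat[OF p] by (simp add: strict_mono_def)
  moreover have "(if p dvd n then f n else 0) = 0" if "n \<notin> range (\<lambda>n. p * n)" for n
    using that by (auto simp: dvd_def)
  ultimately have "(\<lambda>n. if p dvd n then f n else 0) sums (S / real p ^ r)"
    using sums_mono_reindex[OF mono, of "\<lambda>n. if p dvd n then f n else 0" "S / real p ^ r"]
    by simp
  from sums_diff[OF f this] have "(\<lambda>n. if p dvd n then 0 else f n) sums (S - S / real p ^ r)"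
    by (rule back_subst[of "\<lambda>g. g sums _"]) auto
  hence "(\<lambda>n. if p dvd Suc n then 0 else f (Suc n)) sums (S - S / real p ^ r)"
    by (subst sums_Suc_iff) simp
  moreover have "S - S / real p ^ r = zeta r * (\<Prod>p\<in>insert p A. 1 - 1 / real p ^ r)"
    using insert.hyps by (simp add: S_def algebra_simps)
  moreover have "(\<lambda>n. if p dvd Suc n then 0 else f (Suc n)) =
      (\<lambda>n. if \<forall>q\<in>insert p A. \<not> q dvd Suc n then 1 / real (Suc n) ^ r else 0)"
    by (auto simp: f_def)
  ultimately show ?case by simp
qed

text \<open>After sieving by the primes up to y, the survivors are 1 and integers above y. Hence
  zeta(r) times the partial product exceeds 1 by at most a tail of the zeta series.\<close>

lemma zeta_euler_product:
  assumes "r \<ge> 2"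
  shows "(\<lambda>y. \<Prod>p | prime p \<and> p \<le> y. 1 - 1 / real p ^ r) \<longlonglongrightarrow> 1 / zeta r"
proof -
  define c where "c = (\<lambda>n. 1 / real (Suc n) ^ r)"
  define P where "P = (\<lambda>y. \<Prod>p | prime p \<and> p \<le> y. 1 - 1 / real p ^ r)"
  define g where "g = (\<lambda>y n. if \<forall>p\<in>{p. prime p \<and> p \<le> y}. \<not> p dvd Suc n then c n else 0)"
  have g: "g y sums (zeta r * P y)" for y
    unfolding g_def c_def P_def using assms by (intro zeta_sieve) auto
  have c: "c sums zeta r" using zeta_sieve[OF assms, of "{}"] by (simp add: c_def)
  have g0: "g y 0 = 1" for y by (auto simp: g_def c_def)
  have g1: "g y n = 0" if n: "n > 0" "n < y" for y n
  proof -
    obtain p where "prime p" "p dvd Suc n" using prime_factor_nat[of "Suc n"] n by auto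
    moreover from this have "p \<le> y" using n dvd_imp_le[of p "Suc n"] by simp
    ultimately show ?thesis by (auto simp: g_def)
  qed
  have "(\<lambda>y. zeta r * P y - 1) \<longlonglongrightarrow> 0"
  proof (rule tendsto_sandwich)
    have bounds: "0 \<le> zeta r * P y - 1 \<and> zeta r * P y - 1 \<le> zeta r - sum c {..<y}" if "y > 0" for y
    proof -
      have "{..<y} = insert 0 {0<..<y}" using that by auto
      hence "sum (g y) {..<y} = 1" using g0 g1 by simp
      hence "(\<lambda>n. g y (n + y)) sums (zeta r * P y - 1)"
        using sums_split_initial_segment[OF g[of y], of y] by simp
      moreover have "(\<lambda>n. c (n + y)) sums (zeta r - sum c {..<y})"
        by (rule sums_split_initial_segment[OF c])
      moreover have "0 \<le> g y n" "g y n \<le> c n" for n by (auto simp: g_def c_def)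
      ultimately show ?thesis by (metis (no_types, lifting) sums_le sums_zero)
    qed
    show "\<forall>\<^sub>F y in sequentially. 0 \<le> zeta r * P y - 1"
      "\<forall>\<^sub>F y in sequentially. zeta r * P y - 1 \<le> zeta r - sum c {..<y}"
      using bounds by (auto intro: eventually_mono[OF eventually_gt_at_top[of 0]])
    show "(\<lambda>y. zeta r - sum c {..<y}) \<longlonglongrightarrow> 0"
      using tendsto_diff[OF tendsto_const[of "zeta r"] c[unfolded sums_def]] by simp
  qed simp
  hence "(\<lambda>y. zeta r * P y) \<longlonglongrightarrow> 1" by (simp add: LIM_zero_iff)
  \<comment> \<open>Nonvanishing comes for free: if zeta(r) were 0, the zero sequence would converge
    to 1.\<close>
  moreover have "zeta r \<noteq> 0"
  proof
    assume "zeta r = 0"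
    hence "(\<lambda>y::nat. 0::real) \<longlonglongrightarrow> 1" using \<open>(\<lambda>y. zeta r * P y) \<longlonglongrightarrow> 1\<close> by simp
    thus False by (simp add: LIMSEQ_const_iff)
  qed
  ultimately have "(\<lambda>y. zeta r * P y / zeta r) \<longlonglongrightarrow> 1 / zeta r"
    by (intro tendsto_divide tendsto_const)
  thus ?thesis using \<open>zeta r \<noteq> 0\<close> by (simp add: P_def)
qed

subsection \<open>Uniform random tuples\<close>

text \<open>By independence the joint law is the product measure, which gives each point of the box
  mass 1 / n^(card I). These masses add up to 1, so the law lives on the box and measuring S becomes
  counting.\<close>

lemma prob_uniform_tuple:
  fixes X :: "'i \<Rightarrow> 'm \<Rightarrow> nat"
  assumes "prob_space M" "finite I" "I \<noteq> {}" "n > 0"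
    and indep: "prob_space.indep_vars M (\<lambda>_. count_space UNIV) X I"
    and unif: "\<And>j. j \<in> I \<Longrightarrow> distr M (count_space UNIV) (X j) = measure_pmf (pmf_of_set {1..n})"
  shows "measure M {\<omega> \<in> space M. (\<lambda>j\<in>I. X j \<omega>) \<in> S} =
           real (card {x \<in> I \<rightarrow>\<^sub>E {1..n}. x \<in> S}) / real n ^ card I"
proof -
  interpret prob_space M by fact
  define U where "U = measure_pmf (pmf_of_set {1..n})"
  define Y where "Y = (\<lambda>\<omega>. \<lambda>j\<in>I. X j \<omega>)"
  define N where "N = PiM I (\<lambda>_. U)"
  interpret U: prob_space U unfolding U_def by (rule measure_pmf.prob_space_axioms)
  interpret P: finite_product_prob_space "\<lambda>_. U" I by standard fact
  have rv: "random_variable (count_space UNIV) (X j)" if "j \<in> I" for j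
    using indep that by (simp add: indep_vars_def)
  \<comment> \<open>A finite product of countable discrete spaces is discrete, so an arbitrary set
    of extensional tuples is measurable.\<close>
  have cs: "PiM I (\<lambda>_. count_space (UNIV::nat set)) = count_space (PiE I (\<lambda>_. UNIV))"
    using assms(2) by (intro count_space_PiM_finite) auto
  have setsN: "sets N = Pow (PiE I (\<lambda>_. UNIV))"
  proof -
    have "sets N = sets (PiM I (\<lambda>_. count_space (UNIV::nat set)))"
      unfolding N_def U_def by (intro sets_PiM_cong) auto
    thus ?thesis by (simp add: cs)
  qed
  have "distr M (PiM I (\<lambda>_. count_space UNIV)) Y = PiM I (\<lambda>j. distr M (count_space UNIV) (X j))"
    using indep_vars_iff_distr_eq_PiM'[OF assms(3) rv] indep by (simp add: Y_def)
  also have "\<dots> = N" unfolding N_def U_def using unif by (intro PiM_cong) auto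
  finally have distr: "distr M (PiM I (\<lambda>_. count_space UNIV)) Y = N" .
  have Y: "Y \<in> measurable M (PiM I (\<lambda>_. count_space UNIV))"
    unfolding Y_def by (intro measurable_restrict rv)
  have singleton: "measure N {x} = (\<Prod>i\<in>I. pmf (pmf_of_set {1..n}) (x i))" if "x \<in> PiE I (\<lambda>_. UNIV)" for x
  proof -
    have "{x} = PiE I (\<lambda>i. {x i})"
      using PiE_singleton[of x I] that by (simp add: PiE_def)
    moreover have "measure N (PiE I (\<lambda>i. {x i})) = (\<Prod>i\<in>I. measure U {x i})"
      unfolding N_def by (rule P.prob_times) (simp add: U_def)
    ultimately have "measure N {x} = (\<Prod>i\<in>I. measure U {x i})" by simp
    thus ?thesis by (simp add: U_def measure_pmf_single)
  qed
  define B where "B = PiE I (\<lambda>_. {1..n})"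
  have finB: "finite B" unfolding B_def using assms by (intro finite_PiE) auto
  have sub: "B \<subseteq> PiE I (\<lambda>_. UNIV)" by (auto simp: B_def)
  have pB: "measure N {x} = 1 / real n ^ card I" if "x \<in> B" for x
  proof -
    have "pmf (pmf_of_set {1..n}) (x i) = 1 / real n" if "i \<in> I" for i
      using PiE_mem[of x I "\<lambda>_. {1..n}" i] \<open>x \<in> B\<close> that assms by (subst pmf_of_set) (auto simp: B_def)
    thus ?thesis using singleton[of x] sub that by (auto simp: power_one_over)
  qed
  interpret N: prob_space N unfolding N_def by (rule prob_space_PiM) (simp add: U_def measure_pmf.prob_space_axioms)
  have sumB: "measure N A = real (card A) / real n ^ card I" if "A \<subseteq> B" for A
  proof -
    have "measure N A = (\<Sum>x\<in>A. measure N {x})"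
      using that finB sub finite_subset[OF that finB]
      by (intro N.finite_measure_eq_sum_singleton) (auto simp: setsN)
    also have "\<dots> = (\<Sum>x\<in>A. 1 / real n ^ card I)"
      using that by (intro sum.cong pB) auto
    finally show ?thesis by simp
  qed
  have "measure N B = 1"
    using sumB[of B] assms by (simp add: B_def card_PiE)
  \<comment> \<open>\<open>Y\<close> takes only extensional values, so this intersection leaves the
    event unchanged and makes the set measurable.\<close>
  define S' where "S' = S \<inter> PiE I (\<lambda>_. UNIV)"
  have "measure M {\<omega> \<in> space M. (\<lambda>j\<in>I. X j \<omega>) \<in> S} = measure M (Y -` S' \<inter> space M)"
    by (rule arg_cong[where f = "measure M"]) (auto simp: Y_def S'_def)
  also have "\<dots> = measure (distr M (PiM I (\<lambda>_. count_space UNIV)) Y) S'"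
    using Y by (subst measure_distr) (auto simp: cs S'_def)
  also have "\<dots> = measure N S'" by (simp only: distr)
  also have "\<dots> = measure N (S' \<inter> B)"
  proof -
    have "AE x in N. x \<in> B" using \<open>measure N B = 1\<close> sub by (intro N.AE_prob_1) simp
    thus ?thesis using sub by (intro N.finite_measure_eq_AE) (auto simp: setsN S'_def)
  qed
  also have "\<dots> = real (card (S' \<inter> B)) / real n ^ card I" by (intro sumB) auto
  also have "S' \<inter> B = {x \<in> I \<rightarrow>\<^sub>E {1..n}. x \<in> S}" using sub by (auto simp: S'_def B_def)
  finally show ?thesis .
qed

section \<open>Coprimality of tuples as a condition at each prime\<close>

lemma int_dvd_diff_iff_cong: "int m dvd int x - int y \<longleftrightarrow> [x = y] (mod m)"
  by (metis cong_iff_dvd_diff cong_int_iff)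

lemma gcd_eq_1_iff_prime: "gcd x y = 1 \<longleftrightarrow> (\<forall>p. prime p \<longrightarrow> \<not> (p dvd x \<and> p dvd y))" for x y :: nat
  unfolding gcd_greatest_iff[symmetric] using prime_factor_nat[of "gcd x y"] not_prime_unit by fastforce

lemma Gcd_eq_1_iff_prime: "Gcd (x ` I) = 1 \<longleftrightarrow> (\<forall>p. prime p \<longrightarrow> \<not> (\<forall>i\<in>I. p dvd x i))" for x :: "'i \<Rightarrow> nat"
proof -
  have "Gcd (x ` I) = 1 \<longleftrightarrow> (\<forall>p. prime p \<longrightarrow> \<not> p dvd Gcd (x ` I))"
    using prime_factor_nat[of "Gcd (x ` I)"] not_prime_unit by fastforce
  thus ?thesis by (simp add: dvd_Gcd_iff)
qed

text \<open>No prime may divide two coordinates, so any two indices in the set of divisible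
  coordinates coincide: it is empty or a singleton.\<close>

lemma PC_set_box:
  "{x \<in> {1..r} \<rightarrow>\<^sub>E {1..n}. x \<in> PC_set r a b} =
   {x \<in> {1..r} \<rightarrow>\<^sub>E {1..n}. (\<forall>i\<in>{1..r}. [x i = b i] (mod a i)) \<and>
      (\<forall>p. prime p \<longrightarrow> {i\<in>{1..r}. p dvd x i} \<in> insert {} ((\<lambda>i. {i}) ` {1..r}))}"
proof -
  have "D \<in> insert {} ((\<lambda>i. {i}) ` I) \<longleftrightarrow> (\<forall>i\<in>D. \<forall>j\<in>D. i = j)"
    if "D \<subseteq> I" for D I :: "nat set"
  proof (cases "D = {}")
    case False
    then obtain i where "i \<in> D" by blast
    hence "(\<forall>i\<in>D. \<forall>j\<in>D. i = j) \<longleftrightarrow> D = {i}" by blast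
    thus ?thesis using that \<open>i \<in> D\<close> by auto
  qed simp
  hence "{i\<in>I. p dvd x i} \<in> insert {} ((\<lambda>i. {i}) ` I) \<longleftrightarrow>
      (\<forall>i\<in>{i\<in>I. p dvd x i}. \<forall>j\<in>{i\<in>I. p dvd x i}. i = j)"
    for x :: "nat \<Rightarrow> nat" and I p by (metis (no_types, lifting) mem_Collect_eq subsetI)
  hence eq: "(\<forall>i\<in>I. \<forall>j\<in>I. i \<noteq> j \<longrightarrow> gcd (x i) (x j) = 1) \<longleftrightarrow>
        (\<forall>p. prime p \<longrightarrow> {i\<in>I. p dvd x i} \<in> insert {} ((\<lambda>i. {i}) ` I))"
    for x :: "nat \<Rightarrow> nat" and I
    unfolding gcd_eq_1_iff_prime by (simp only: mem_Collect_eq ball_simps) blast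
  have sub: "x \<in> {1..r} \<rightarrow>\<^sub>E {0<..}" if "x \<in> {1..r} \<rightarrow>\<^sub>E {1..n}" for x :: "nat \<Rightarrow> nat"
    using that by (rule subsetD[OF PiE_mono, rotated]) auto
  show ?thesis
  proof (intro Collect_cong conj_cong refl)
    fix x :: "nat \<Rightarrow> nat" assume "x \<in> {1..r} \<rightarrow>\<^sub>E {1..n}"
    thus "x \<in> PC_set r a b \<longleftrightarrow> (\<forall>i\<in>{1..r}. [x i = b i] (mod a i)) \<and>
        (\<forall>p. prime p \<longrightarrow> {i\<in>{1..r}. p dvd x i} \<in> insert {} ((\<lambda>i. {i}) ` {1..r}))"
      unfolding PC_set_def mem_Collect_eq int_dvd_diff_iff_cong eq
      by (simp only: sub simp_thms conj_commute)
  qed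
qed

lemma C_set_box:
  "{x \<in> {1..r} \<rightarrow>\<^sub>E {1..n}. x \<in> C_set r a b} =
   {x \<in> {1..r} \<rightarrow>\<^sub>E {1..n}. (\<forall>i\<in>{1..r}. [x i = b i] (mod a i)) \<and>
      (\<forall>p. prime p \<longrightarrow> {i\<in>{1..r}. p dvd x i} \<in> Pow {1..r} - {{1..r}})}"
proof -
  have eq: "Gcd (x ` I) = 1 \<longleftrightarrow> (\<forall>p. prime p \<longrightarrow> {i\<in>I. p dvd x i} \<in> Pow I - {I})"
    for x :: "nat \<Rightarrow> nat" and I
    unfolding Gcd_eq_1_iff_prime by blast
  have sub: "x \<in> {1..r} \<rightarrow>\<^sub>E {0<..}" if "x \<in> {1..r} \<rightarrow>\<^sub>E {1..n}" for x :: "nat \<Rightarrow> nat"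
    using that by (rule subsetD[OF PiE_mono, rotated]) auto
  show ?thesis
  proof (intro Collect_cong conj_cong refl)
    fix x :: "nat \<Rightarrow> nat" assume "x \<in> {1..r} \<rightarrow>\<^sub>E {1..n}"
    thus "x \<in> C_set r a b \<longleftrightarrow> (\<forall>i\<in>{1..r}. [x i = b i] (mod a i)) \<and>
        (\<forall>p. prime p \<longrightarrow> {i\<in>{1..r}. p dvd x i} \<in> Pow {1..r} - {{1..r}})"
      unfolding C_set_def mem_Collect_eq int_dvd_diff_iff_cong eq
      by (simp only: sub simp_thms conj_commute)
  qed
qed

theorem theorem3p5:
  fixes r :: nat
    and a b :: "nat \<Rightarrow> nat"
    and M :: "nat \<Rightarrow> 'm measure"
    and X :: "nat \<Rightarrow> nat \<Rightarrow> 'm \<Rightarrow> nat"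
  assumes r: "r \<ge> 2"
    and a_pos: "\<And>i. i \<in> {1..r} \<Longrightarrow> a i > 0"
    and a_coprime: "\<And>i j. i \<in> {1..r} \<Longrightarrow> j \<in> {1..r} \<Longrightarrow> i \<noteq> j \<Longrightarrow> coprime (a i) (a j)"
    and b: "\<And>j. j \<in> {1..r} \<Longrightarrow> b j \<le> a j - 1"
    and M: "\<And>n. n \<ge> 2 \<Longrightarrow> prob_space (M n)"
    and X_indep: "\<And>n. n \<ge> 2 \<Longrightarrow>
          prob_space.indep_vars (M n) (\<lambda>_. count_space UNIV) (X n) {1..r}"
    and X_uniform: "\<And>n j. n \<ge> 2 \<Longrightarrow> j \<in> {1..r} \<Longrightarrow>
          distr (M n) (count_space UNIV) (X n j) = measure_pmf (pmf_of_set {1..n})"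
  shows "((\<lambda>n. measure (M n) {\<omega> \<in> space (M n). (\<lambda>j\<in>{1..r}. X n j \<omega>) \<in> PC_set r a b}) \<longlonglongrightarrow>
          T_const r * (Psi (int r - 2) (\<Prod>i=1..r. a i) / Psi (int r - 1) (\<Prod>i=1..r. a i))
            * (1 / real (totient (\<Prod>i=1..r. a i)))
            * (\<Prod>i=1..r. real (totient (gcd (a i) (b i))) / Psi (int r - 2) (gcd (a i) (b i))))
       \<and> ((\<lambda>n. measure (M n) {\<omega> \<in> space (M n). (\<lambda>j\<in>{1..r}. X n j \<omega>) \<in> C_set r a b}) \<longlonglongrightarrow>
          1 / zeta (real r) * (1 / real (\<Prod>i=1..r. a i))
            * (real (\<Prod>i=1..r. a i) ^ r / jordan_totient r (\<Prod>i=1..r. a i))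
            * (\<Prod>i=1..r. jordan_totient (r - 1) (gcd (a i) (b i)) / real (gcd (a i) (b i)) ^ (r - 1)))"
proof -
  define I where "I = {1..r}"
  define N where "N = prod a I"
  have I: "finite I" "card I = r" "I \<noteq> {}" using r by (auto simp: I_def)
  have a: "a i > 0" if "i \<in> I" for i using a_pos that by (simp add: I_def)
  have cop: "coprime (a i) (a j)" if "i \<in> I" "j \<in> I" "i \<noteq> j" for i j
    using a_coprime that by (simp add: I_def)
  have N: "N > 0" unfolding N_def using a by (intro prod_pos) auto
  have g: "gcd (a i) (b i) > 0" if "i \<in> I" for i using a[OF that] by simp
  have prob: "(\<lambda>n. measure (M n) {\<omega> \<in> space (M n). (\<lambda>j\<in>{1..r}. X n j \<omega>) \<in> S}) \<longlonglongrightarrow> l"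
    if lim: "(\<lambda>n. real (card {x \<in> I \<rightarrow>\<^sub>E {1..n}. x \<in> S}) / real n ^ card I) \<longlonglongrightarrow> l" for S l
  proof -
    have "measure (M n) {\<omega> \<in> space (M n). (\<lambda>j\<in>{1..r}. X n j \<omega>) \<in> S} =
        real (card {x \<in> I \<rightarrow>\<^sub>E {1..n}. x \<in> S}) / real n ^ card I" if "n \<ge> 2" for n
      unfolding I_def using M[OF that] X_indep[OF that] X_uniform[OF that] that r
      by (intro prob_uniform_tuple) auto
    hence "\<forall>\<^sub>F n in sequentially. real (card {x \<in> I \<rightarrow>\<^sub>E {1..n}. x \<in> S}) / real n ^ card I =
        measure (M n) {\<omega> \<in> space (M n). (\<lambda>j\<in>{1..r}. X n j \<omega>) \<in> S}"
      by (intro eventually_sequentiallyI[of 2]) simp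
    thus ?thesis by (rule Lim_transform_eventually[OF lim])
  qed
  \<comment> \<open>The factors N of the two \<open>Psi\<close> values cancel, and phi(N) = N times
    the product of 1 - 1/p supplies both the 1 / N and the remaining denominators. In each gcd
    quotient the leading gcd cancels likewise.\<close>
  have pc: "T_const r * (\<Prod>p\<in>prime_factors N.
        (1 + (real r - 2) / real p) / (1 + (real r - 1) / real p) / (1 - 1 / real p) *
        (if dvd_some_gcd I a b p then (1 - 1 / real p) / (1 + (real r - 2) / real p) else 1)) / real N =
      T_const r * (Psi (int r - 2) N / Psi (int r - 1) N) * (1 / real (totient N)) *
        (\<Prod>i\<in>I. real (totient (gcd (a i) (b i))) / Psi (int r - 2) (gcd (a i) (b i)))"
  proof -
    have "(\<Prod>i\<in>I. real (totient (gcd (a i) (b i))) / Psi (int r - 2) (gcd (a i) (b i))) =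
        (\<Prod>i\<in>I. \<Prod>p\<in>prime_factors (gcd (a i) (b i)). (1 - 1 / real p) / (1 + (real r - 2) / real p))"
      using g by (intro prod.cong) (simp_all add: Psi_def totient_formula2 prod_dividef)
    also have "\<dots> = (\<Prod>p\<in>prime_factors N.
        if dvd_some_gcd I a b p then (1 - 1 / real p) / (1 + (real r - 2) / real p) else 1)"
      unfolding N_def using I a cop by (intro prod_prime_factors_gcd) auto
    finally show ?thesis using N
      by (simp add: Psi_def totient_formula2 prod_dividef prod.distrib mult_ac)
  qed
  \<comment> \<open>The powers of N in N^r / phi_r(N) cancel, leaving the product of 1 / (1 - 1/p^r)
    over the primes of N.\<close>
  have c: "1 / zeta r * (\<Prod>p\<in>prime_factors N. 1 / (1 - 1 / real p ^ r) *
        (if dvd_some_gcd I a b p then 1 - 1 / real p ^ (r - 1) else 1)) / real N =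
      1 / zeta (real r) * (1 / real N) * (real N ^ r / jordan_totient r N) *
        (\<Prod>i\<in>I. jordan_totient (r - 1) (gcd (a i) (b i)) / real (gcd (a i) (b i)) ^ (r - 1))"
  proof -
    have "(\<Prod>i\<in>I. jordan_totient (r - 1) (gcd (a i) (b i)) / real (gcd (a i) (b i)) ^ (r - 1)) =
        (\<Prod>i\<in>I. \<Prod>p\<in>prime_factors (gcd (a i) (b i)). 1 - 1 / real p ^ (r - 1))"
      using a by (intro prod.cong) (auto simp: jordan_totient_def)
    also have "\<dots> = (\<Prod>p\<in>prime_factors N. if dvd_some_gcd I a b p then 1 - 1 / real p ^ (r - 1) else 1)"
      unfolding N_def using I a cop by (intro prod_prime_factors_gcd) auto
    finally show ?thesis using N I
      by (simp add: jordan_totient_def prod_dividef prod.distrib mult_ac)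
  qed
  have "(\<lambda>n. real (card {x \<in> I \<rightarrow>\<^sub>E {1..n}. x \<in> PC_set r a b}) / real n ^ card I) \<longlonglongrightarrow>
      T_const r * (\<Prod>p\<in>prime_factors N.
        (1 + (real r - 2) / real p) / (1 + (real r - 1) / real p) / (1 - 1 / real p) *
        (if dvd_some_gcd I a b p then (1 - 1 / real p) / (1 + (real r - 2) / real p) else 1)) / real N"
    unfolding I_def PC_set_box unfolding I_def[symmetric] N_def
  proof (rule density_sieve)
    show "(\<lambda>y. \<Prod>p | prime p \<and> p \<le> y. local_density I (insert {} ((\<lambda>i. {i}) ` I)) a b p) \<longlonglongrightarrow>
      T_const r * (\<Prod>p\<in>prime_factors (prod a I).
        (1 + (real r - 2) / real p) / (1 + (real r - 1) / real p) / (1 - 1 / real p) *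
        (if dvd_some_gcd I a b p then (1 - 1 / real p) / (1 + (real r - 2) / real p) else 1))"
    proof (subst prod.cong[OF refl])
      show "local_density I (insert {} ((\<lambda>i. {i}) ` I)) a b p = T_factor r p *
        (if p dvd prod a I then
          (1 + (real r - 2) / real p) / (1 + (real r - 1) / real p) / (1 - 1 / real p) *
          (if dvd_some_gcd I a b p then (1 - 1 / real p) / (1 + (real r - 2) / real p) else 1) else 1)"
        if "p \<in> {p. prime p \<and> p \<le> y}" for p y
        by (rule local_density_at_most_one_factor) (use I r cop that in auto)
    qed (rule prod_primes_tendsto_correction[OF T_const_limit[OF r] N[unfolded N_def]])
  qed (use I a in auto)
  moreover have "(\<lambda>n. real (card {x \<in> I \<rightarrow>\<^sub>E {1..n}. x \<in> C_set r a b}) / real n ^ card I) \<longlonglongrightarrow>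
      1 / zeta r * (\<Prod>p\<in>prime_factors N. 1 / (1 - 1 / real p ^ r) *
        (if dvd_some_gcd I a b p then 1 - 1 / real p ^ (r - 1) else 1)) / real N"
    unfolding I_def C_set_box unfolding I_def[symmetric] N_def
  proof (rule density_sieve)
    show "(\<lambda>y. \<Prod>p | prime p \<and> p \<le> y. local_density I (Pow I - {I}) a b p) \<longlonglongrightarrow>
      1 / zeta r * (\<Prod>p\<in>prime_factors (prod a I). 1 / (1 - 1 / real p ^ r) *
        (if dvd_some_gcd I a b p then 1 - 1 / real p ^ (r - 1) else 1))"
    proof (subst prod.cong[OF refl])
      show "local_density I (Pow I - {I}) a b p = (1 - 1 / real p ^ r) *
        (if p dvd prod a I then 1 / (1 - 1 / real p ^ r) *
          (if dvd_some_gcd I a b p then 1 - 1 / real p ^ (r - 1) else 1) else 1)"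
        if "p \<in> {p. prime p \<and> p \<le> y}" for p y
        by (rule local_density_not_all_factor) (use I r cop that in auto)
    qed (rule prod_primes_tendsto_correction[OF
          zeta_euler_product[OF r] N[unfolded N_def]])
    \<comment> \<open>A singleton is a proper subset because r >= 2.\<close>
    show "{i} \<in> Pow I - {I}" if "i \<in> I" for i
    proof -
      have "{i} \<noteq> I" using I(2) r by auto
      thus ?thesis using that by simp
    qed
  qed (use I a in auto)
  ultimately show ?thesis
    unfolding pc c by (intro conjI prob) (simp_all add: I_def N_def)
qed

end
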